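(* Let $\tilde{\boldsymbol y}\in[0,1]^m$, and for each $j\in J_Q$ let $i(j)\in\arg\min_{i\in I_j}\{1-(1-p_{ij})\tilde y_i\}$. Then the Benders optimality cut $$\sum_{j\in J_Q}d_j\bigl(1-(1-p_{i(j)j})\,y_{i(j)}\bigr)+\sum_{j\in J_N}d_j\sum_{i\in I_j}p_{ij}\,y_i\;\ge\;\vartheta$$ is globally valid: for every $\boldsymbol y\in[0,1]^m$ and every $\vartheta\le V(\boldsymbol y)$ the inequality holds. Moreover it is tight at $\tilde{\boldsymbol y}$: for $\boldsymbol y=\tilde{\boldsymbol y}$ its left-hand side equals $\sum_{j\in J}d_j\min\{\tilde Q_j,\tilde N_j\}=V(\tilde{\boldsymbol y})$. The cut can be computed in $O\bigl(\sum_{j\in J}|I_j|\bigr)$ time.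
   Context: $I=\{1,\dots,m\}$ is a finite set of candidate locations, $J=\{1,\dots,n\}$ a finite set of customers, $d_j>0$ the weight of customer $j$, $p_{ij}\in[0,1]$ the coverage level provided by location $i$ to customer $j$, and $I_j=\{i\in I:0<p_{ij}\le 1\}$ (possibly empty). For the fixed vector $\tilde{\boldsymbol y}\in[0,1]^m$ define, for each $j\in J$, $\tilde Q_j=\min_{i\in I_j}\{1-(1-p_{ij})\tilde y_i\}$ if $I_j\ne\varnothing$ and $\tilde Q_j=1$ if $I_j=\varnothing$; and $\tilde N_j=\sum_{i\in I_j}p_{ij}\tilde y_i$ (empty sum equal to $0$). Let $J_Q=\{j\in J:\tilde Q_j<\tilde N_j\}$ and $J_N=\{j\in J:\tilde N_j\le\tilde Q_j\}$. (If $j\in J_Q$ then $I_j\neq\varnothing$.) For $\boldsymbol y\in[0,1]^m$, $V(\boldsymbol y)$ denotes the optimal value of the projection problem $\max\{\sum_{j\in J}d_jr_j:\ r_j\le 1-(1-p_{ij})y_i\ (j\in J, i\in I_j),\ r_j\le\sum_{i\in I_j}p_{ij}y_i\ (j\in J),\ r_j\ge 0\ (j\in J)\}$. In the Benders master problem of the follower, $\vartheta$ is the variable representing the follower objective value, so a cut is globally valid if it is satisfied by every $(\boldsymbol y,\vartheta)$ with $\boldsymbol y\in[0,1]^m$ and $\vartheta\le V(\boldsymbol y)$. The running time counts elementary arithmetic operations and comparisons. *)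

theory Defs
  imports Complex_Main
begin

text \<open>Vectors indexed by the locations \<open>{1..m}\<close> or the customers \<open>{1..n}\<close> are functions on
  \<open>nat\<close>, of which only the values on these sets matter.\<close>

definition covering_instance ::
  "nat \<Rightarrow> nat \<Rightarrow> (nat \<Rightarrow> real) \<Rightarrow> (nat \<Rightarrow> nat \<Rightarrow> real) \<Rightarrow> bool" where
  "covering_instance m n d p \<longleftrightarrow>
     (\<forall>j\<in>{1..n}. 0 < d j) \<and> (\<forall>i\<in>{1..m}. \<forall>j\<in>{1..n}. 0 \<le> p i j \<and> p i j \<le> 1)"

definition unit_box :: "nat \<Rightarrow> (nat \<Rightarrow> real) set" where
  "unit_box m = {y. \<forall>i\<in>{1..m}. 0 \<le> y i \<and> y i \<le> 1}"

definition cover :: "nat \<Rightarrow> (nat \<Rightarrow> nat \<Rightarrow> real) \<Rightarrow> nat \<Rightarrow> nat set" where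
  "cover m p j = {i \<in> {1..m}. 0 < p i j \<and> p i j \<le> 1}"

definition Q :: "nat \<Rightarrow> (nat \<Rightarrow> nat \<Rightarrow> real) \<Rightarrow> (nat \<Rightarrow> real) \<Rightarrow> nat \<Rightarrow> real" where
  "Q m p y j = (if cover m p j = {} then 1
                else Min ((\<lambda>i. 1 - (1 - p i j) * y i) ` cover m p j))"

definition N :: "nat \<Rightarrow> (nat \<Rightarrow> nat \<Rightarrow> real) \<Rightarrow> (nat \<Rightarrow> real) \<Rightarrow> nat \<Rightarrow> real" where
  "N m p y j = (\<Sum>i\<in>cover m p j. p i j * y i)"

definition JQ :: "nat \<Rightarrow> nat \<Rightarrow> (nat \<Rightarrow> nat \<Rightarrow> real) \<Rightarrow> (nat \<Rightarrow> real) \<Rightarrow> nat set" where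
  "JQ m n p y = {j \<in> {1..n}. Q m p y j < N m p y j}"

definition JN :: "nat \<Rightarrow> nat \<Rightarrow> (nat \<Rightarrow> nat \<Rightarrow> real) \<Rightarrow> (nat \<Rightarrow> real) \<Rightarrow> nat set" where
  "JN m n p y = {j \<in> {1..n}. N m p y j \<le> Q m p y j}"

definition feasible ::
  "nat \<Rightarrow> nat \<Rightarrow> (nat \<Rightarrow> nat \<Rightarrow> real) \<Rightarrow> (nat \<Rightarrow> real) \<Rightarrow> (nat \<Rightarrow> real) set" where
  "feasible m n p y =
     {r. (\<forall>j\<in>{1..n}. \<forall>i\<in>cover m p j. r j \<le> 1 - (1 - p i j) * y i) \<and>
         (\<forall>j\<in>{1..n}. r j \<le> (\<Sum>i\<in>cover m p j. p i j * y i)) \<and>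
         (\<forall>j\<in>{1..n}. 0 \<le> r j)}"

text \<open>For \<open>y\<close> in the unit box the feasible set is nonempty and the objective is bounded above on
  it, so the supremum is a genuine one.\<close>

definition V ::
  "nat \<Rightarrow> nat \<Rightarrow> (nat \<Rightarrow> real) \<Rightarrow> (nat \<Rightarrow> nat \<Rightarrow> real) \<Rightarrow> (nat \<Rightarrow> real) \<Rightarrow> real" where
  "V m n d p y = (SUP r\<in>feasible m n p y. \<Sum>j\<in>{1..n}. d j * r j)"

definition is_minimizer ::
  "nat \<Rightarrow> (nat \<Rightarrow> nat \<Rightarrow> real) \<Rightarrow> (nat \<Rightarrow> real) \<Rightarrow> nat \<Rightarrow> nat \<Rightarrow> bool" where
  "is_minimizer m p y j i \<longleftrightarrow>
     is_arg_min (\<lambda>i. 1 - (1 - p i j) * y i) (\<lambda>i. i \<in> cover m p j) i"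

text \<open>The left-hand side of the cut generated at \<open>yt\<close> with minimizers \<open>sel j\<close>, evaluated
  at \<open>y\<close>.\<close>

definition cut_lhs ::
  "nat \<Rightarrow> nat \<Rightarrow> (nat \<Rightarrow> real) \<Rightarrow> (nat \<Rightarrow> nat \<Rightarrow> real) \<Rightarrow> (nat \<Rightarrow> real) \<Rightarrow> (nat \<Rightarrow> nat)
     \<Rightarrow> (nat \<Rightarrow> real) \<Rightarrow> real" where
  "cut_lhs m n d p yt sel y =
     (\<Sum>j\<in>JQ m n p yt. d j * (1 - (1 - p (sel j) j) * y (sel j))) +
     (\<Sum>j\<in>JN m n p yt. d j * (\<Sum>i\<in>cover m p j. p i j * y i))"


section \<open>Cost model\<close>

text \<open>A small imperative language over real and index arrays. Array cells are addressed by tuples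
  of loop variables, and the only loops run over index lists belonging to the (read-only) input.
  Every real arithmetic operation, every comparison and every assignment costs one step. Loop
  control involves neither arithmetic nor comparisons of numbers and is free; charging it would
  add a term \<open>n\<close>, because customers that no location covers are also enumerated.\<close>

type_synonym vname = string

datatype iexp =
    LoopVar vname
  | IRead vname "vname list"

datatype rexp =
    Const int
  | RRead vname "vname list"
  | Add rexp rexp
  | Sub rexp rexp
  | Mul rexp rexp
  | Div rexp rexp

datatype bexp =
    RLess rexp rexp
  | REq rexp rexp
  | IEq iexp iexp

datatype com =
    Skip
  | RAssign vname "vname list" rexp
  | IAssign vname "vname list" iexp
  | Seq com com
  | Cond bexp com com
  | Foreach vname vname "vname list" com

record state =
  reals :: "vname \<Rightarrow> nat list \<Rightarrow> real"
  idxs  :: "vname \<Rightarrow> nat list \<Rightarrow> nat"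
  lists :: "vname \<Rightarrow> nat list \<Rightarrow> nat list"
  env   :: "vname \<Rightarrow> nat"

abbreviation addr :: "state \<Rightarrow> vname list \<Rightarrow> nat list" where
  "addr s xs \<equiv> map (env s) xs"

primrec ival :: "iexp \<Rightarrow> state \<Rightarrow> nat" where
  "ival (LoopVar x) s = env s x"
| "ival (IRead a xs) s = idxs s a (addr s xs)"

primrec rval :: "rexp \<Rightarrow> state \<Rightarrow> real" where
  "rval (Const k) s = of_int k"
| "rval (RRead a xs) s = reals s a (addr s xs)"
| "rval (Add e f) s = rval e s + rval f s"
| "rval (Sub e f) s = rval e s - rval f s"
| "rval (Mul e f) s = rval e s * rval f s"
| "rval (Div e f) s = rval e s / rval f s"

primrec bval :: "bexp \<Rightarrow> state \<Rightarrow> bool" where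
  "bval (RLess e f) s \<longleftrightarrow> rval e s < rval f s"
| "bval (REq e f) s \<longleftrightarrow> rval e s = rval f s"
| "bval (IEq e f) s \<longleftrightarrow> ival e s = ival f s"

primrec rcost :: "rexp \<Rightarrow> nat" where
  "rcost (Const k) = 0"
| "rcost (RRead a xs) = 0"
| "rcost (Add e f) = rcost e + rcost f + 1"
| "rcost (Sub e f) = rcost e + rcost f + 1"
| "rcost (Mul e f) = rcost e + rcost f + 1"
| "rcost (Div e f) = rcost e + rcost f + 1"

primrec bcost :: "bexp \<Rightarrow> nat" where
  "bcost (RLess e f) = rcost e + rcost f + 1"
| "bcost (REq e f) = rcost e + rcost f + 1"
| "bcost (IEq e f) = 1"

definition set_real :: "vname \<Rightarrow> nat list \<Rightarrow> real \<Rightarrow> state \<Rightarrow> state" where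
  "set_real a ks x s = s\<lparr>reals := (reals s)(a := (reals s a)(ks := x))\<rparr>"

definition set_idx :: "vname \<Rightarrow> nat list \<Rightarrow> nat \<Rightarrow> state \<Rightarrow> state" where
  "set_idx a ks k s = s\<lparr>idxs := (idxs s)(a := (idxs s a)(ks := k))\<rparr>"

definition set_loop_var :: "vname \<Rightarrow> nat \<Rightarrow> state \<Rightarrow> state" where
  "set_loop_var x k s = s\<lparr>env := (env s)(x := k)\<rparr>"

text \<open>\<open>exec c s\<close> is the final state together with the number of steps.\<close>

primrec exec :: "com \<Rightarrow> state \<Rightarrow> state \<times> nat" where
  "exec Skip s = (s, 0)"
| "exec (RAssign a xs e) s = (set_real a (addr s xs) (rval e s) s, rcost e + 1)"
| "exec (IAssign a xs e) s = (set_idx a (addr s xs) (ival e s) s, 1)"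
| "exec (Seq c1 c2) s =
     (let (s1, t1) = exec c1 s; (s2, t2) = exec c2 s1 in (s2, t1 + t2))"
| "exec (Cond b c1 c2) s =
     (let (s', t) = (if bval b s then exec c1 s else exec c2 s) in (s', bcost b + t))"
| "exec (Foreach x l xs c) s =
     fold (\<lambda>k (s1, t1). let (s2, t2) = exec c (set_loop_var x k s1) in (s2, t1 + t2))
          (lists s l (addr s xs)) (s, 0)"

text \<open>The input consists of \<open>d\<close>, \<open>p\<close>, \<open>yt\<close>, a list \<open>Js\<close> of the customers, lists \<open>Is j\<close> of the
  locations covering customer \<open>j\<close>, and a preference \<open>tie\<close> that resolves ties between minimizers.
  All other cells are initially zero; in particular the zero coefficients of a cut need not be
  written.\<close>

definition input_state ::
  "(nat \<Rightarrow> real) \<Rightarrow> (nat \<Rightarrow> nat \<Rightarrow> real) \<Rightarrow> (nat \<Rightarrow> real) \<Rightarrow> nat list \<Rightarrow> (nat \<Rightarrow> nat list)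
     \<Rightarrow> (nat \<Rightarrow> nat) \<Rightarrow> state" where
  "input_state d p yt Js Is tie =
     \<lparr>reals = (\<lambda>a ks. case ks of
                  [k] \<Rightarrow> if a = ''d'' then d k else if a = ''y'' then yt k else 0
                | [i, j] \<Rightarrow> if a = ''p'' then p i j else 0
                | _ \<Rightarrow> 0),
      idxs = (\<lambda>a ks. case ks of [j] \<Rightarrow> if a = ''tie'' then tie j else 0 | _ \<Rightarrow> 0),
      lists = (\<lambda>a ks. case ks of
                  [] \<Rightarrow> if a = ''J'' then Js else []
                | [j] \<Rightarrow> if a = ''I'' then Is j else []
                | _ \<Rightarrow> []),
      env = (\<lambda>x. 0)\<rparr>"

definition run_time :: "com \<Rightarrow> state \<Rightarrow> nat" where
  "run_time c s = snd (exec c s)"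

text \<open>A cut is output as its constant term and its coefficients.\<close>

definition output_lhs :: "nat \<Rightarrow> com \<Rightarrow> state \<Rightarrow> (nat \<Rightarrow> real) \<Rightarrow> real" where
  "output_lhs m c s y =
     reals (fst (exec c s)) ''const'' [] +
     (\<Sum>i\<in>{1..m}. reals (fst (exec c s)) ''coef'' [i] * y i)"

end

theory Submission
  imports Defs
begin

text \<open>The constraints of the projection problem do not couple different customers: they say
  exactly \<open>0 \<le> r j \<le> min (Q j) (N j)\<close>. Since all weights are positive, the optimum takes every
  \<open>r j\<close> as large as possible, so \<open>V y\<close> is the weighted sum of \<open>min (Q j) (N j)\<close> (\<open>V_eq\<close>). A
  cut replaces each minimum by a single affine function of \<open>y\<close> that occurs in it, namely one
  that attains it at the point generating the cut. Replacing a minimum by one of its members can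
  only increase it, which gives validity everywhere (\<open>cut_valid\<close>), and it changes nothing at the
  generating point, which gives tightness (\<open>cut_tight\<close>).

  For the running time a program is exhibited that, for each customer, passes four times over the
  locations covering it, at a bounded cost per location: one pass accumulates \<open>N j\<close> and
  \<open>1 - Q j\<close>, two passes select a minimizing location, and the last adds the contribution of the
  customer to the cut. All steps happen inside these passes, so a customer without covering
  locations costs nothing, and its contribution is indeed zero. The semantics of loops is reduced
  to a rule that proves an invariant and a cost bound together (\<open>exec_Foreach_rule\<close>). The exact
  effects of the four passes are composed in \<open>customer_step\<close> and summed over the customers in
  \<open>cut_program_correct\<close>.\<close>


section \<open>The projection problem separates over the customers\<close>

lemma finite_cover [simp]: "finite (cover m p j)"
  by (simp add: cover_def)

lemma Q_le:
  assumes "i \<in> cover m p j"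
  shows "Q m p y j \<le> 1 - (1 - p i j) * y i"
  using assms by (auto simp: Q_def)

lemma Q_eq_minimizer:
  assumes "is_minimizer m p y j i"
  shows "Q m p y j = 1 - (1 - p i j) * y i"
proof -
  have i: "i \<in> cover m p j"
    and least: "\<And>k. k \<in> cover m p j \<Longrightarrow> 1 - (1 - p i j) * y i \<le> 1 - (1 - p k j) * y k"
    using assms by (auto simp: is_minimizer_def is_arg_min_def not_less)
  then show ?thesis
    by (auto simp: Q_def intro!: Min_eqI)
qed

lemma le_Q_iff:
  assumes "cover m p j \<noteq> {}"
  shows "x \<le> Q m p y j \<longleftrightarrow> (\<forall>i\<in>cover m p j. x \<le> 1 - (1 - p i j) * y i)"
  using assms by (simp add: Q_def)

lemma Q_nonneg:
  assumes "y \<in> unit_box m"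
  shows "0 \<le> Q m p y j"
proof (cases "cover m p j = {}")
  case False
  have "0 \<le> 1 - (1 - p i j) * y i" if "i \<in> cover m p j" for i
  proof -
    have "(1 - p i j) * y i \<le> 1"
      using that assms by (intro mult_le_one) (auto simp: cover_def unit_box_def)
    then show ?thesis by simp
  qed
  with False show ?thesis by (simp add: le_Q_iff)
qed (simp add: Q_def)

lemma N_nonneg:
  assumes "y \<in> unit_box m"
  shows "0 \<le> N m p y j"
  unfolding N_def
  using assms by (intro sum_nonneg mult_nonneg_nonneg) (auto simp: cover_def unit_box_def)

text \<open>A customer that no location covers has \<open>N = 0 < 1 = Q\<close>; this is the only case in which
  the constraints do not bound \<open>r j\<close> by \<open>Q\<close> directly.\<close>

lemma feasible_iff:
  "r \<in> feasible m n p y \<longleftrightarrow>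
     (\<forall>j\<in>{1..n}. 0 \<le> r j \<and> r j \<le> min (Q m p y j) (N m p y j))"
proof -
  have "(\<forall>i\<in>cover m p j. r j \<le> 1 - (1 - p i j) * y i) \<and> r j \<le> N m p y j
        \<longleftrightarrow> r j \<le> min (Q m p y j) (N m p y j)" for j
  proof (cases "cover m p j = {}")
    case True
    then show ?thesis by (auto simp: Q_def N_def)
  next
    case False
    then show ?thesis by (simp add: le_Q_iff)
  qed
  then show ?thesis
    unfolding feasible_def N_def[symmetric] by blast
qed

text \<open>The bound \<open>min (Q j) (N j)\<close> is itself feasible because both members are nonnegative on the
  unit box, so it attains the supremum.\<close>

lemma V_eq:
  assumes inst: "covering_instance m n d p" and y: "y \<in> unit_box m"
  shows "V m n d p y = (\<Sum>j\<in>{1..n}. d j * min (Q m p y j) (N m p y j))"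
  unfolding V_def
proof (rule cSup_eq_maximum)
  let ?r = "\<lambda>j. min (Q m p y j) (N m p y j)"
  have "?r \<in> feasible m n p y"
    using Q_nonneg[OF y] N_nonneg[OF y] by (simp add: feasible_iff)
  then show "(\<Sum>j\<in>{1..n}. d j * ?r j) \<in> (\<lambda>r. \<Sum>j\<in>{1..n}. d j * r j) ` feasible m n p y"
    by (rule imageI)
next
  fix v
  assume "v \<in> (\<lambda>r. \<Sum>j\<in>{1..n}. d j * r j) ` feasible m n p y"
  then obtain r where r: "r \<in> feasible m n p y" and v: "v = (\<Sum>j\<in>{1..n}. d j * r j)"
    by blast
  show "v \<le> (\<Sum>j\<in>{1..n}. d j * min (Q m p y j) (N m p y j))"
    unfolding v
  proof (rule sum_mono)
    fix j assume j: "j \<in> {1..n}"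
    with inst have "0 \<le> d j"
      by (auto simp: covering_instance_def less_imp_le)
    moreover have "r j \<le> min (Q m p y j) (N m p y j)"
      using r j by (simp add: feasible_iff)
    ultimately show "d j * r j \<le> d j * min (Q m p y j) (N m p y j)"
      by (rule mult_left_mono[rotated])
  qed
qed

lemma sum_JQ_JN:
  "(\<Sum>j\<in>JQ m n p y. f j) + (\<Sum>j\<in>JN m n p y. g j) =
     (\<Sum>j\<in>{1..n}. if Q m p y j < N m p y j then f j else (g j :: real))"
proof -
  have "JN m n p y = {j \<in> {1..n}. \<not> Q m p y j < N m p y j}"
    by (simp add: JN_def not_less)
  then show ?thesis
    by (simp add: JQ_def sum.If_cases Int_def Collect_neg_eq)
qed

lemma cut_lhs_eq:
  "cut_lhs m n d p yt sel y =
     (\<Sum>j\<in>{1..n}. d j * (if Q m p yt j < N m p yt j then 1 - (1 - p (sel j) j) * y (sel j)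
                          else N m p y j))"
  unfolding cut_lhs_def N_def[symmetric] sum_JQ_JN by (intro sum.cong) auto

text \<open>Each summand of the cut is one of the upper bounds that the constraints impose on \<open>r j\<close>,
  and which of them is chosen does not depend on the point \<open>y\<close> at which the cut is evaluated.\<close>

lemma cut_valid:
  assumes inst: "covering_instance m n d p" and y: "y \<in> unit_box m"
    and sel: "\<forall>j\<in>JQ m n p yt. is_minimizer m p yt j (sel j)"
  shows "V m n d p y \<le> cut_lhs m n d p yt sel y"
  unfolding V_eq[OF inst y] cut_lhs_eq
proof (intro sum_mono mult_left_mono)
  fix j assume j: "j \<in> {1..n}"
  with inst show "0 \<le> d j"
    by (auto simp: covering_instance_def less_imp_le)
  show "min (Q m p y j) (N m p y j) \<le>
      (if Q m p yt j < N m p yt j then 1 - (1 - p (sel j) j) * y (sel j) else N m p y j)"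
  proof (cases "Q m p yt j < N m p yt j")
    case True
    then have "sel j \<in> cover m p j"
      using sel j by (auto simp: JQ_def is_minimizer_def is_arg_min_def)
    then show ?thesis
      using Q_le[of "sel j" m p j y] True by simp
  qed simp
qed

text \<open>At the generating point the summand chosen for \<open>j\<close> is the smaller of \<open>Q j\<close> and \<open>N j\<close>, by
  the definition of the partition into \<open>JQ\<close> and \<open>JN\<close>.\<close>

lemma cut_tight:
  assumes sel: "\<forall>j\<in>JQ m n p yt. is_minimizer m p yt j (sel j)"
  shows "cut_lhs m n d p yt sel yt = (\<Sum>j\<in>{1..n}. d j * min (Q m p yt j) (N m p yt j))"
  unfolding cut_lhs_eq
proof (intro sum.cong refl)
  fix j assume j: "j \<in> {1..n}"
  show "d j * (if Q m p yt j < N m p yt j then 1 - (1 - p (sel j) j) * yt (sel j)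
          else N m p yt j) = d j * min (Q m p yt j) (N m p yt j)"
  proof (cases "Q m p yt j < N m p yt j")
    case True
    then have "Q m p yt j = 1 - (1 - p (sel j) j) * yt (sel j)"
      using sel j by (intro Q_eq_minimizer) (auto simp: JQ_def)
    with True show ?thesis by simp
  qed simp
qed


section \<open>Reasoning about programs\<close>

lemma exec_Seq:
  "fst (exec (Seq c1 c2) s) = fst (exec c2 (fst (exec c1 s)))"
  "snd (exec (Seq c1 c2) s) = snd (exec c1 s) + snd (exec c2 (fst (exec c1 s)))"
  by (simp_all add: split_beta Let_def)

lemma exec_Cond:
  "fst (exec (Cond b c1 c2) s) = fst (if bval b s then exec c1 s else exec c2 s)"
  "snd (exec (Cond b c1 c2) s) = bcost b + snd (if bval b s then exec c1 s else exec c2 s)"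
  by (simp_all add: split_beta Let_def)

text \<open>The invariant \<open>P\<close> refers to the list of iterations already done. Cost and correctness are
  established together because the cost of one iteration may depend on the state that the
  invariant describes: the cost of the outer loop body is determined by the lengths of input
  lists, which have to be known to be intact.\<close>

lemma exec_Foreach_rule:
  assumes init: "P [] s"
    and step: "\<And>ks k rest t. lists s l (addr s xs) = ks @ k # rest \<Longrightarrow> P ks t \<Longrightarrow>
        P (ks @ [k]) (fst (exec c (set_loop_var x k t))) \<and>
        snd (exec c (set_loop_var x k t)) \<le> B k"
  shows "P (lists s l (addr s xs)) (fst (exec (Foreach x l xs c) s)) \<and>
    snd (exec (Foreach x l xs c) s) \<le> (\<Sum>k\<leftarrow>lists s l (addr s xs). B k)"
proof -
  let ?f = "\<lambda>k z. (fst (exec c (set_loop_var x k (fst z))),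
                     snd z + snd (exec c (set_loop_var x k (fst z))))"
  have exec_eq: "exec (Foreach x l xs c) s = fold ?f (lists s l (addr s xs)) (s, 0)"
    by (simp add: case_prod_unfold Let_def)
  have "P ks (fst (fold ?f ks (s, 0))) \<and> snd (fold ?f ks (s, 0)) \<le> (\<Sum>k\<leftarrow>ks. B k)"
    if "lists s l (addr s xs) = ks @ rest" for ks rest
    using that
  proof (induction ks arbitrary: rest rule: rev_induct)
    case Nil
    with init show ?case by simp
  next
    case (snoc k ks)
    then have IH: "P ks (fst (fold ?f ks (s, 0)))"
        "snd (fold ?f ks (s, 0)) \<le> (\<Sum>k\<leftarrow>ks. B k)"
      by auto
    with step[of ks k rest, OF _ IH(1)] snoc.prems show ?case
      by (auto intro: add_mono)
  qed
  from this[of "lists s l (addr s xs)" "[]"] show ?thesis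
    unfolding exec_eq by simp
qed

lemma sum_list_const_le: "(\<Sum>k\<leftarrow>xs. (B::nat)) = B * length xs"
  by (induction xs) auto


section \<open>The cut-generation program\<close>

text \<open>The \<^emph>\<open>loss\<close> of location \<open>i\<close> for customer \<open>j\<close> is \<open>(1 - p i j) * y i\<close>, so \<open>Q\<close> is one minus
  the largest loss. Losses are nonnegative, hence the maximum may be accumulated in a cell that
  starts at zero, and no cell has to be initialised. This matters: a step spent on each customer
  outside the loops over its locations would not be paid for by the sizes of the cover sets.\<close>

definition loss_exp :: rexp where
  "loss_exp = Mul (Sub (Const 1) (RRead ''p'' [''i'', ''j''])) (RRead ''y'' [''i''])"

definition scan :: com where
  "scan = Foreach ''i'' ''I'' [''j'']
     (Seq (RAssign ''N'' [''j''] (Add (RRead ''N'' [''j''])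
             (Mul (RRead ''p'' [''i'', ''j'']) (RRead ''y'' [''i'']))))
          (Cond (RLess (RRead ''M'' [''j'']) loss_exp) (RAssign ''M'' [''j''] loss_exp) Skip))"

text \<open>A tie preference can only be honoured once the maximal loss is known, and it may name a
  location that is not a minimizer. Hence some minimizer is selected first, and a second pass
  replaces it by the preferred one if that qualifies.\<close>

definition choose_any :: com where
  "choose_any = Foreach ''i'' ''I'' [''j'']
     (Cond (REq loss_exp (RRead ''M'' [''j'']))
        (IAssign ''best'' [''j''] (LoopVar ''i'')) Skip)"

definition choose_tie :: com where
  "choose_tie = Foreach ''i'' ''I'' [''j'']
     (Cond (IEq (LoopVar ''i'') (IRead ''tie'' [''j'']))
        (Cond (REq loss_exp (RRead ''M'' [''j'']))
           (IAssign ''best'' [''j''] (LoopVar ''i'')) Skip) Skip)"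

text \<open>Arrays are addressed by loop variables only, so the coefficient of the chosen location is
  written when the loop meets that location. The constant term is updated at the same moment,
  hence exactly once because the list has no repetitions.\<close>

definition emit :: com where
  "emit = Foreach ''i'' ''I'' [''j'']
     (Cond (RLess (Sub (Const 1) (RRead ''M'' [''j''])) (RRead ''N'' [''j'']))
        (Cond (IEq (LoopVar ''i'') (IRead ''best'' [''j'']))
           (Seq (RAssign ''const'' [] (Add (RRead ''const'' []) (RRead ''d'' [''j''])))
                (RAssign ''coef'' [''i''] (Sub (RRead ''coef'' [''i''])
                   (Mul (RRead ''d'' [''j'']) (Sub (Const 1) (RRead ''p'' [''i'', ''j'']))))))
           Skip)
        (RAssign ''coef'' [''i''] (Add (RRead ''coef'' [''i''])
           (Mul (RRead ''d'' [''j'']) (RRead ''p'' [''i'', ''j''])))))"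

definition cut_program :: com where
  "cut_program = Foreach ''j'' ''J'' [] (Seq scan (Seq choose_any (Seq choose_tie emit)))"

abbreviation loss :: "state \<Rightarrow> nat \<Rightarrow> real" where
  "loss s i \<equiv> (1 - reals s ''p'' [i, env s ''j'']) * reals s ''y'' [i]"

abbreviation locations :: "state \<Rightarrow> nat list" where
  "locations s \<equiv> lists s ''I'' [env s ''j'']"

lemma rval_loss_exp: "rval loss_exp s = loss s (env s ''i'')"
  by (simp add: loss_exp_def)

lemma rcost_loss_exp: "rcost loss_exp = 2"
  by (simp add: loss_exp_def)

lemmas exec_simps = exec_Seq exec_Cond rval_loss_exp rcost_loss_exp
  set_real_def set_idx_def set_loop_var_def

lemma scan_correct:
  assumes "j = env s ''j''"
  shows "(let t = fst (exec scan s) in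
      env t ''j'' = j \<and> lists t = lists s \<and> idxs t = idxs s \<and>
      reals t = (reals s)
        (''N'' := (reals s ''N'')([j] := reals s ''N'' [j] +
                    (\<Sum>i\<leftarrow>locations s. reals s ''p'' [i, j] * reals s ''y'' [i])),
         ''M'' := (reals s ''M'')([j] := Max (insert (reals s ''M'' [j])
                    (loss s ` set (locations s)))))) \<and>
    snd (exec scan s) \<le> 9 * length (locations s)"
proof -
  define M where "M ks = Max (insert (reals s ''M'' [j]) (loss s ` set ks))" for ks
  have M_Nil: "M [] = reals s ''M'' [j]" by (simp add: M_def)
  have M_snoc: "M (ks @ [k]) = max (loss s k) (M ks)" for ks k
    unfolding M_def by (subst Max_insert[symmetric]) (auto simp: insert_commute)
  define P where "P ks t \<longleftrightarrow>
      env t ''j'' = j \<and> lists t = lists s \<and> idxs t = idxs s \<and>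
      reals t = (reals s)
        (''N'' := (reals s ''N'')([j] := reals s ''N'' [j] +
                    (\<Sum>i\<leftarrow>ks. reals s ''p'' [i, j] * reals s ''y'' [i])),
         ''M'' := (reals s ''M'')([j] := M ks))"
    for ks and t :: state
  let ?l = "lists s ''I'' (addr s [''j''])"
  have "P ?l (fst (exec scan s)) \<and> snd (exec scan s) \<le> (\<Sum>k\<leftarrow>?l. 9)"
    unfolding scan_def
  proof (rule exec_Foreach_rule)
    show "P [] s" by (simp add: P_def M_Nil assms fun_eq_iff)
  next
    fix ks k t
    assume P: "P ks t"
    let ?c = "Seq (RAssign ''N'' [''j''] (Add (RRead ''N'' [''j''])
             (Mul (RRead ''p'' [''i'', ''j'']) (RRead ''y'' [''i'']))))
          (Cond (RLess (RRead ''M'' [''j'']) loss_exp) (RAssign ''M'' [''j''] loss_exp) Skip)"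
    show "P (ks @ [k]) (fst (exec ?c (set_loop_var ''i'' k t))) \<and>
        snd (exec ?c (set_loop_var ''i'' k t)) \<le> 9"
      using P assms unfolding P_def M_snoc
      by (auto simp: exec_simps fun_eq_iff max_def)
  qed
  then show ?thesis
    using assms by (simp add: P_def M_def Let_def sum_list_const_le)
qed

text \<open>Both selection loops overwrite the cell at every location that qualifies, so the last one
  remains.\<close>

lemma choose_any_correct:
  assumes "j = env s ''j''"
  shows "(let t = fst (exec choose_any s) in
      env t ''j'' = j \<and> lists t = lists s \<and> reals t = reals s \<and>
      idxs t = (idxs s)(''best'' := (idxs s ''best'')([j] :=
        last (idxs s ''best'' [j] #
          filter (\<lambda>i. loss s i = reals s ''M'' [j]) (locations s))))) \<and>
    snd (exec choose_any s) \<le> 4 * length (locations s)"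
proof -
  define P where "P ks t \<longleftrightarrow>
      env t ''j'' = j \<and> lists t = lists s \<and> reals t = reals s \<and>
      idxs t = (idxs s)(''best'' := (idxs s ''best'')([j] :=
        last (idxs s ''best'' [j] # filter (\<lambda>i. loss s i = reals s ''M'' [j]) ks)))"
    for ks and t :: state
  let ?l = "lists s ''I'' (addr s [''j''])"
  have "P ?l (fst (exec choose_any s)) \<and> snd (exec choose_any s) \<le> (\<Sum>k\<leftarrow>?l. 4)"
    unfolding choose_any_def
  proof (rule exec_Foreach_rule)
    show "P [] s" by (simp add: P_def assms fun_eq_iff)
  next
    fix ks k t
    assume P: "P ks t"
    let ?c = "Cond (REq loss_exp (RRead ''M'' [''j'']))
        (IAssign ''best'' [''j''] (LoopVar ''i'')) Skip"
    show "P (ks @ [k]) (fst (exec ?c (set_loop_var ''i'' k t))) \<and>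
        snd (exec ?c (set_loop_var ''i'' k t)) \<le> 4"
      using P assms unfolding P_def
      by (auto simp: exec_simps fun_eq_iff)
  qed
  then show ?thesis
    using assms by (simp add: P_def Let_def sum_list_const_le)
qed

lemma choose_tie_correct:
  assumes "j = env s ''j''"
  shows "(let t = fst (exec choose_tie s) in
      env t ''j'' = j \<and> lists t = lists s \<and> reals t = reals s \<and>
      idxs t = (idxs s)(''best'' := (idxs s ''best'')([j] :=
        last (idxs s ''best'' [j] #
          filter (\<lambda>i. i = idxs s ''tie'' [j] \<and> loss s i = reals s ''M'' [j])
            (locations s))))) \<and>
    snd (exec choose_tie s) \<le> 5 * length (locations s)"
proof -
  define P where "P ks t \<longleftrightarrow>
      env t ''j'' = j \<and> lists t = lists s \<and> reals t = reals s \<and>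
      idxs t = (idxs s)(''best'' := (idxs s ''best'')([j] :=
        last (idxs s ''best'' [j] #
          filter (\<lambda>i. i = idxs s ''tie'' [j] \<and> loss s i = reals s ''M'' [j]) ks)))"
    for ks and t :: state
  let ?l = "lists s ''I'' (addr s [''j''])"
  have "P ?l (fst (exec choose_tie s)) \<and> snd (exec choose_tie s) \<le> (\<Sum>k\<leftarrow>?l. 5)"
    unfolding choose_tie_def
  proof (rule exec_Foreach_rule)
    show "P [] s" by (simp add: P_def assms fun_eq_iff)
  next
    fix ks k t
    assume P: "P ks t"
    let ?c = "Cond (IEq (LoopVar ''i'') (IRead ''tie'' [''j'']))
        (Cond (REq loss_exp (RRead ''M'' [''j'']))
           (IAssign ''best'' [''j''] (LoopVar ''i'')) Skip) Skip"
    show "P (ks @ [k]) (fst (exec ?c (set_loop_var ''i'' k t))) \<and>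
        snd (exec ?c (set_loop_var ''i'' k t)) \<le> 5"
      using P assms unfolding P_def
      by (auto simp: exec_simps fun_eq_iff)
  qed
  then show ?thesis
    using assms by (simp add: P_def Let_def sum_list_const_le)
qed

text \<open>Distinctness of the list is essential here: a repeated location would be counted twice.
  The membership test in the constant term covers the empty list, for which the loop writes
  nothing whatever the comparison would have given.\<close>

lemma emit_correct:
  assumes "j = env s ''j''" and dist: "distinct (locations s)"
    and g: "g = (\<lambda>i. if 1 - reals s ''M'' [j] < reals s ''N'' [j]
        then if i = idxs s ''best'' [j]
             then - (reals s ''d'' [j] * (1 - reals s ''p'' [i, j])) else 0
        else reals s ''d'' [j] * reals s ''p'' [i, j])"
  shows "(let t = fst (exec emit s) in
      lists t = lists s \<and> idxs t = idxs s \<and>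
      (\<forall>a. a \<noteq> ''const'' \<and> a \<noteq> ''coef'' \<longrightarrow> reals t a = reals s a) \<and>
      reals t ''const'' [] = reals s ''const'' [] +
        (if 1 - reals s ''M'' [j] < reals s ''N'' [j] \<and>
            idxs s ''best'' [j] \<in> set (locations s) then reals s ''d'' [j] else 0) \<and>
      (\<forall>i. reals t ''coef'' [i] = reals s ''coef'' [i] +
        (if i \<in> set (locations s) then g i else 0))) \<and>
    snd (exec emit s) \<le> 9 * length (locations s)"
proof -
  define P where "P ks t \<longleftrightarrow>
      env t ''j'' = j \<and> lists t = lists s \<and> idxs t = idxs s \<and>
      (\<forall>a. a \<noteq> ''const'' \<and> a \<noteq> ''coef'' \<longrightarrow> reals t a = reals s a) \<and>
      reals t ''const'' [] = reals s ''const'' [] +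
        (if 1 - reals s ''M'' [j] < reals s ''N'' [j] \<and>
            idxs s ''best'' [j] \<in> set ks then reals s ''d'' [j] else 0) \<and>
      (\<forall>i. reals t ''coef'' [i] = reals s ''coef'' [i] + (if i \<in> set ks then g i else 0))"
    for ks and t :: state
  let ?l = "lists s ''I'' (addr s [''j''])"
  have "P ?l (fst (exec emit s)) \<and> snd (exec emit s) \<le> (\<Sum>k\<leftarrow>?l. 9)"
    unfolding emit_def
  proof (rule exec_Foreach_rule)
    show "P [] s" by (simp add: P_def assms(1))
  next
    fix ks k rest t
    assume P: "P ks t" and l: "?l = ks @ k # rest"
    then have k: "k \<notin> set ks" using dist by simp
    let ?c = "Cond (RLess (Sub (Const 1) (RRead ''M'' [''j''])) (RRead ''N'' [''j'']))
        (Cond (IEq (LoopVar ''i'') (IRead ''best'' [''j'']))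
           (Seq (RAssign ''const'' [] (Add (RRead ''const'' []) (RRead ''d'' [''j''])))
                (RAssign ''coef'' [''i''] (Sub (RRead ''coef'' [''i''])
                   (Mul (RRead ''d'' [''j'']) (Sub (Const 1) (RRead ''p'' [''i'', ''j'']))))))
           Skip)
        (RAssign ''coef'' [''i''] (Add (RRead ''coef'' [''i''])
           (Mul (RRead ''d'' [''j'']) (RRead ''p'' [''i'', ''j'']))))"
    show "P (ks @ [k]) (fst (exec ?c (set_loop_var ''i'' k t))) \<and>
        snd (exec ?c (set_loop_var ''i'' k t)) \<le> 9"
      using P k unfolding P_def g
      by (auto simp: exec_simps)
  qed
  then show ?thesis
    using assms(1) by (simp add: P_def Let_def sum_list_const_le)
qed


section \<open>Correctness of the program\<close>

text \<open>The location held in \<open>best\<close> after both selection passes. The \<open>0\<close> under the maximum and at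
  the head of the list are the initial contents of the cells \<open>M\<close> and \<open>best\<close>.\<close>

definition selected :: "(nat \<Rightarrow> real) \<Rightarrow> nat list \<Rightarrow> nat \<Rightarrow> nat" where
  "selected w xs t = last (0 # filter (\<lambda>i. w i = Max (insert 0 (w ` set xs))) xs @
     filter (\<lambda>i. i = t \<and> w i = Max (insert 0 (w ` set xs))) xs)"

lemma selected_properties:
  fixes w :: "nat \<Rightarrow> real"
  assumes ne: "xs \<noteq> []" and nonneg: "\<And>i. i \<in> set xs \<Longrightarrow> 0 \<le> w i"
  shows "selected w xs t \<in> set xs" and "w (selected w xs t) = Max (w ` set xs)"
    and "t \<in> set xs \<Longrightarrow> w t = Max (w ` set xs) \<Longrightarrow> selected w xs t = t"
proof -
  obtain i where i: "i \<in> set xs" using ne by (cases xs) auto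
  then have "w i \<le> Max (w ` set xs)"
    by simp
  then have "0 \<le> Max (w ` set xs)"
    using nonneg[OF i] by linarith
  then have max0: "Max (insert 0 (w ` set xs)) = Max (w ` set xs)"
    using ne
    by (simp only: Max_insert finite_imageI finite_set image_is_empty set_empty max_absorb2
        not_False_eq_True)
  define mx where "mx = Max (w ` set xs)"
  let ?A = "filter (\<lambda>i. w i = mx) xs"
  let ?B = "filter (\<lambda>i. i = t \<and> w i = mx) xs"
  have sel: "selected w xs t = last (0 # ?A @ ?B)"
    unfolding selected_def max0 mx_def ..
  have "mx \<in> w ` set xs"
    unfolding mx_def using i by (intro Max_in) auto
  then have "?A \<noteq> []"
    by (auto simp: filter_empty_conv)
  then have ne_AB: "?A @ ?B \<noteq> []"
    unfolding append_is_Nil_conv by blast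
  then have "selected w xs t \<in> set (?A @ ?B)"
    unfolding sel last_ConsR[OF ne_AB] by (rule last_in_set)
  then show "selected w xs t \<in> set xs" "w (selected w xs t) = Max (w ` set xs)"
    unfolding mx_def[symmetric] by auto
  assume "t \<in> set xs" "w t = Max (w ` set xs)"
  then have B: "?B \<noteq> []"
    unfolding mx_def[symmetric] filter_empty_conv by blast
  then have "last ?B \<in> set ?B"
    by (rule last_in_set)
  moreover have "selected w xs t = last ?B"
    unfolding sel last_ConsR[OF ne_AB] using B by (rule last_appendR)
  ultimately show "selected w xs t = t"
    by simp
qed

lemma Q_eq_Max:
  assumes "cover m p j \<noteq> {}"
  shows "Q m p y j = 1 - Max ((\<lambda>i. (1 - p i j) * y i) ` cover m p j)"
proof -
  let ?w = "\<lambda>i. (1 - p i j) * y i"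
  have "Min ((\<lambda>i. 1 - ?w i) ` cover m p j) = 1 - Max (?w ` cover m p j)"
  proof (rule Min_eqI)
    have "Max (?w ` cover m p j) \<in> ?w ` cover m p j"
      using assms by (intro Max_in) auto
    then show "1 - Max (?w ` cover m p j) \<in> (\<lambda>i. 1 - ?w i) ` cover m p j"
      by auto
  qed auto
  then show ?thesis
    using assms by (simp add: Q_def)
qed

text \<open>Minimizing \<open>1 - (1 - p i j) * y i\<close> is maximizing the loss, which is what the program
  does.\<close>

lemma is_minimizer_iff:
  assumes "i \<in> cover m p j"
  shows "is_minimizer m p y j i \<longleftrightarrow>
    (1 - p i j) * y i = Max ((\<lambda>i. (1 - p i j) * y i) ` cover m p j)"
proof -
  let ?w = "\<lambda>i. (1 - p i j) * y i"
  have "?w i = Max (?w ` cover m p j) \<longleftrightarrow> (\<forall>k\<in>cover m p j. ?w k \<le> ?w i)"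
    using assms by (auto intro!: Max_eqI[symmetric])
  then show ?thesis
    using assms by (auto simp: is_minimizer_def is_arg_min_def not_less)
qed

text \<open>The list of customers is left out: it is read once, before the outer loop starts.\<close>

definition input_intact ::
  "(nat \<Rightarrow> real) \<Rightarrow> (nat \<Rightarrow> nat \<Rightarrow> real) \<Rightarrow> (nat \<Rightarrow> real) \<Rightarrow> (nat \<Rightarrow> nat list)
     \<Rightarrow> (nat \<Rightarrow> nat) \<Rightarrow> state \<Rightarrow> bool" where
  "input_intact d p yt Is tie s \<longleftrightarrow>
     (\<forall>j. reals s ''d'' [j] = d j) \<and> (\<forall>i. reals s ''y'' [i] = yt i) \<and>
     (\<forall>i j. reals s ''p'' [i, j] = p i j) \<and>
     (\<forall>j. lists s ''I'' [j] = Is j) \<and> (\<forall>j. idxs s ''tie'' [j] = tie j)"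

definition scratch_clear :: "nat \<Rightarrow> state \<Rightarrow> bool" where
  "scratch_clear j s \<longleftrightarrow>
     reals s ''N'' [j] = 0 \<and> reals s ''M'' [j] = 0 \<and> idxs s ''best'' [j] = 0"

definition cut_const ::
  "nat \<Rightarrow> (nat \<Rightarrow> real) \<Rightarrow> (nat \<Rightarrow> nat \<Rightarrow> real) \<Rightarrow> (nat \<Rightarrow> real) \<Rightarrow> nat \<Rightarrow> real" where
  "cut_const m d p yt j = (if Q m p yt j < N m p yt j then d j else 0)"

definition cut_coef ::
  "nat \<Rightarrow> (nat \<Rightarrow> real) \<Rightarrow> (nat \<Rightarrow> nat \<Rightarrow> real) \<Rightarrow> (nat \<Rightarrow> real) \<Rightarrow> (nat \<Rightarrow> nat)
     \<Rightarrow> nat \<Rightarrow> nat \<Rightarrow> real" where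
  "cut_coef m d p yt sel j i =
     (if i \<in> cover m p j
      then if Q m p yt j < N m p yt j
           then if i = sel j then - (d j * (1 - p i j)) else 0
           else d j * p i j
      else 0)"

text \<open>The cut is grouped by customers, the output by locations; passing from one to the other
  interchanges two finite sums.\<close>

lemma cut_lhs_eq_coefs:
  assumes sel: "\<forall>j\<in>JQ m n p yt. sel j \<in> cover m p j"
  shows "cut_lhs m n d p yt sel y =
    (\<Sum>j\<in>{1..n}. cut_const m d p yt j) +
    (\<Sum>i\<in>{1..m}. (\<Sum>j\<in>{1..n}. cut_coef m d p yt sel j i) * y i)"
proof -
  have "d j * (if Q m p yt j < N m p yt j then 1 - (1 - p (sel j) j) * y (sel j) else N m p y j)
      = cut_const m d p yt j + (\<Sum>i\<in>{1..m}. cut_coef m d p yt sel j i * y i)"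
    if j: "j \<in> {1..n}" for j
  proof (cases "Q m p yt j < N m p yt j")
    case True
    then have "sel j \<in> cover m p j"
      using sel j by (auto simp: JQ_def)
    then have sel_m: "sel j \<in> {1..m}" and "cut_coef m d p yt sel j i * y i =
        (if i = sel j then - (d j * (1 - p i j)) * y i else 0)" for i
      using True by (auto simp: cut_coef_def cover_def)
    then have "(\<Sum>i\<in>{1..m}. cut_coef m d p yt sel j i * y i) =
        - (d j * (1 - p (sel j) j)) * y (sel j)"
      by simp
    with True show ?thesis
      by (simp add: cut_const_def algebra_simps)
  next
    case False
    have "(\<Sum>i\<in>{1..m}. cut_coef m d p yt sel j i * y i) =
        (\<Sum>i\<in>cover m p j. d j * (p i j * y i))"
      using False by (intro sum.mono_neutral_cong_right) (auto simp: cut_coef_def cover_def)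
    with False show ?thesis
      by (simp add: cut_const_def N_def sum_distrib_left)
  qed
  then have "cut_lhs m n d p yt sel y = (\<Sum>j\<in>{1..n}. cut_const m d p yt j +
      (\<Sum>i\<in>{1..m}. cut_coef m d p yt sel j i * y i))"
    unfolding cut_lhs_eq by (intro sum.cong) auto
  also have "\<dots> = (\<Sum>j\<in>{1..n}. cut_const m d p yt j) +
      (\<Sum>i\<in>{1..m}. \<Sum>j\<in>{1..n}. cut_coef m d p yt sel j i * y i)"
    by (simp add: sum.distrib) (rule sum.swap)
  finally show ?thesis
    by (simp add: sum_distrib_right)
qed

text \<open>The comparison \<open>1 - M < N\<close> agrees with \<open>Q < N\<close> for a covered customer because \<open>M\<close> started
  at zero, below all losses; hence the assumption that the cells of \<open>j\<close> are clear. For an uncovered customer no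
  pass does anything, and both parts of its contribution vanish because \<open>N = 0 < Q\<close> and there
  are no coefficients. The factor 27 is the sum of the costs 9, 4, 5 and 9 per location of the
  four passes.\<close>

lemma customer_step:
  fixes d p yt
  defines "body \<equiv> Seq scan (Seq choose_any (Seq choose_tie emit))"
  assumes intact: "input_intact d p yt Is tie s" and j: "env s ''j'' = j"
    and clear: "scratch_clear j s"
    and dist: "distinct (Is j)" and set: "set (Is j) = cover m p j"
    and nonneg: "\<And>i. i \<in> cover m p j \<Longrightarrow> 0 \<le> (1 - p i j) * yt i"
    and sel: "sel j = selected (\<lambda>i. (1 - p i j) * yt i) (Is j) (tie j)"
  shows "(let t = fst (exec body s) in
      input_intact d p yt Is tie t \<and>
      (\<forall>k. k \<noteq> j \<longrightarrow> scratch_clear k s \<longrightarrow> scratch_clear k t) \<and>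
      reals t ''const'' [] = reals s ''const'' [] + cut_const m d p yt j \<and>
      (\<forall>i. reals t ''coef'' [i] = reals s ''coef'' [i] + cut_coef m d p yt sel j i)) \<and>
    snd (exec body s) \<le> 27 * length (Is j)"
proof -
  let ?w = "\<lambda>i. (1 - p i j) * yt i"
  define M where "M = Max (insert 0 (?w ` set (Is j)))"
  define a where "a = fst (exec scan s)"
  define b where "b = fst (exec choose_any a)"
  define c where "c = fst (exec choose_tie b)"
  define t where "t = fst (exec emit c)"
  note input = intact[unfolded input_intact_def]
  note scratch = clear[unfolded scratch_clear_def]
  have "(\<Sum>i\<leftarrow>Is j. p i j * yt i) = N m p yt j"
    using dist set by (simp add: N_def sum_list_distinct_conv_sum_set)
  then have a: "env a ''j'' = j" "lists a = lists s" "idxs a = idxs s"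
      "reals a = (reals s)(''N'' := (reals s ''N'')([j] := N m p yt j),
         ''M'' := (reals s ''M'')([j] := M))"
    and cost_a: "snd (exec scan s) \<le> 9 * length (Is j)"
    using scan_correct[OF j[symmetric]] input scratch
    unfolding a_def[symmetric] Let_def M_def j by auto
  have b: "env b ''j'' = j" "lists b = lists s" "reals b = reals a"
      "idxs b = (idxs s)(''best'' := (idxs s ''best'')([j] :=
         last (0 # filter (\<lambda>i. ?w i = M) (Is j))))"
    and cost_b: "snd (exec choose_any a) \<le> 4 * length (Is j)"
    using choose_any_correct[OF a(1)[symmetric]] input scratch
    unfolding b_def[symmetric] Let_def a by auto
  have "last (last (0 # filter (\<lambda>i. ?w i = M) (Is j)) #
        filter (\<lambda>i. i = tie j \<and> ?w i = M) (Is j)) = sel j"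
    unfolding sel selected_def M_def[symmetric] by simp
  then have c: "env c ''j'' = j" "lists c = lists s" "reals c = reals a"
      "idxs c = (idxs s)(''best'' := (idxs s ''best'')([j] := sel j))"
    and cost_c: "snd (exec choose_tie b) \<le> 5 * length (Is j)"
    using choose_tie_correct[OF b(1)[symmetric]] input
    unfolding c_def[symmetric] Let_def b a by auto
  have M_iff: "1 - M < N m p yt j \<longleftrightarrow> Q m p yt j < N m p yt j"
    and sel_in: "sel j \<in> set (Is j)" if "Is j \<noteq> []"
  proof -
    have ne: "cover m p j \<noteq> {}" using that set by auto
    have pos: "\<And>i. i \<in> set (Is j) \<Longrightarrow> 0 \<le> ?w i" using nonneg set by simp
    show sel_in: "sel j \<in> set (Is j)"
      unfolding sel using that pos by (rule selected_properties(1))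
    then have "?w (sel j) \<le> Max (?w ` set (Is j))"
      by simp
    then have "0 \<le> Max (?w ` set (Is j))"
      using pos[OF sel_in] by linarith
    then have "M = Max (?w ` set (Is j))"
      unfolding M_def using that
      by (simp only: Max_insert finite_imageI finite_set image_is_empty set_empty max_absorb2
          not_False_eq_True)
    then show "1 - M < N m p yt j \<longleftrightarrow> Q m p yt j < N m p yt j"
      using Q_eq_Max[OF ne] set by simp
  qed
  have dist_c: "distinct (locations c)"
    using dist input c by simp
  have t: "lists t = lists s" "idxs t = idxs c"
      "\<And>x. x \<noteq> ''const'' \<Longrightarrow> x \<noteq> ''coef'' \<Longrightarrow> reals t x = reals a x"
      "reals t ''const'' [] = reals s ''const'' [] +
        (if 1 - M < N m p yt j \<and> sel j \<in> set (Is j) then d j else 0)"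
      "\<And>i. reals t ''coef'' [i] = reals s ''coef'' [i] +
        (if i \<in> set (Is j)
         then if 1 - M < N m p yt j
              then if i = sel j then - (d j * (1 - p i j)) else 0
              else d j * p i j
         else 0)"
    and cost_t: "snd (exec emit c) \<le> 9 * length (Is j)"
    using emit_correct[OF c(1)[symmetric] dist_c refl] input
    unfolding t_def[symmetric] Let_def c a by auto
  have const: "(if 1 - M < N m p yt j \<and> sel j \<in> set (Is j) then d j else 0) =
      cut_const m d p yt j"
  proof (cases "Is j = []")
    case True
    then have "cover m p j = {}" using set by simp
    then show ?thesis
      using True by (simp add: cut_const_def Q_def N_def)
  next
    case False
    then show ?thesis
      using M_iff sel_in by (simp add: cut_const_def)
  qed
  have coef: "(if i \<in> set (Is j)
         then if 1 - M < N m p yt j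
              then if i = sel j then - (d j * (1 - p i j)) else 0
              else d j * p i j
         else 0) = cut_coef m d p yt sel j i" for i
    using M_iff set by (cases "Is j = []") (auto simp: cut_coef_def)
  have t_const: "reals t ''const'' [] = reals s ''const'' [] + cut_const m d p yt j"
    unfolding t(4) const ..
  have t_coef: "reals t ''coef'' [i] = reals s ''coef'' [i] + cut_coef m d p yt sel j i" for i
    unfolding t(5) coef ..
  have body_t: "fst (exec body s) = t"
    unfolding body_def t_def c_def b_def a_def exec_Seq ..
  have "snd (exec body s) \<le> 27 * length (Is j)"
    unfolding body_def exec_Seq a_def[symmetric] b_def[symmetric] c_def[symmetric]
    using cost_a cost_b cost_c cost_t by linarith
  moreover have "input_intact d p yt Is tie t"
    using input unfolding input_intact_def by (simp add: t c a)
  moreover have "scratch_clear k s \<Longrightarrow> scratch_clear k t" if "k \<noteq> j" for k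
    using that unfolding scratch_clear_def by (simp add: t c a)
  ultimately show ?thesis
    unfolding Let_def body_t t_const t_coef by blast
qed

text \<open>Each customer is processed once, so the cells of the customers still to come are untouched
  and hence zero; this part of the invariant replaces any initialisation.\<close>

lemma cut_program_correct:
  fixes d :: "nat \<Rightarrow> real"
  assumes nonneg: "\<And>i j. j \<in> {1..n} \<Longrightarrow> i \<in> cover m p j \<Longrightarrow> 0 \<le> (1 - p i j) * yt i"
    and Js: "distinct Js" "set Js = {1..n}"
    and Is: "\<And>j. j \<in> {1..n} \<Longrightarrow> distinct (Is j) \<and> set (Is j) = cover m p j"
    and sel: "sel = (\<lambda>j. selected (\<lambda>i. (1 - p i j) * yt i) (Is j) (tie j))"
  defines "s0 \<equiv> input_state d p yt Js Is tie"
  shows "reals (fst (exec cut_program s0)) ''const'' [] = (\<Sum>j\<in>{1..n}. cut_const m d p yt j)"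
    and "reals (fst (exec cut_program s0)) ''coef'' [i] =
      (\<Sum>j\<in>{1..n}. cut_coef m d p yt sel j i)"
    and "run_time cut_program s0 \<le> 27 * (\<Sum>j\<in>{1..n}. card (cover m p j))"
proof -
  define P where "P ks t \<longleftrightarrow>
      input_intact d p yt Is tie t \<and>
      (\<forall>k. k \<notin> set ks \<longrightarrow> scratch_clear k t) \<and>
      reals t ''const'' [] = (\<Sum>j\<in>set ks. cut_const m d p yt j) \<and>
      (\<forall>i. reals t ''coef'' [i] = (\<Sum>j\<in>set ks. cut_coef m d p yt sel j i))"
    for ks and t :: state
  let ?l = "lists s0 ''J'' (addr s0 [])"
  have l: "?l = Js"
    by (simp add: s0_def input_state_def)
  have "P ?l (fst (exec cut_program s0)) \<and>
      snd (exec cut_program s0) \<le> (\<Sum>j\<leftarrow>?l. 27 * length (Is j))"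
    unfolding cut_program_def
  proof (rule exec_Foreach_rule)
    show "P [] s0"
      by (simp add: P_def s0_def input_state_def input_intact_def scratch_clear_def)
  next
    fix ks j rest t
    assume split: "?l = ks @ j # rest" and P: "P ks t"
    have "Js = ks @ j # rest"
      using split l by simp
    with Js(1) have "j \<in> set Js" "j \<notin> set ks"
      by auto
    then have j: "j \<in> {1..n}" "j \<notin> set ks"
      unfolding Js(2) .
    let ?s = "set_loop_var ''j'' j t"
    have intact: "input_intact d p yt Is tie ?s" and clear: "scratch_clear j ?s"
      and env: "env ?s ''j'' = j"
      using P j by (auto simp: P_def set_loop_var_def input_intact_def scratch_clear_def)
    have reals: "reals ?s = reals t"
      and clears: "\<And>k. scratch_clear k ?s = scratch_clear k t"
      by (simp_all add: set_loop_var_def scratch_clear_def)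
    show "P (ks @ [j]) (fst (exec (Seq scan (Seq choose_any (Seq choose_tie emit))) ?s)) \<and>
        snd (exec (Seq scan (Seq choose_any (Seq choose_tie emit))) ?s) \<le> 27 * length (Is j)"
      using customer_step[where m = m and sel = sel, OF intact env clear]
        Is[OF j(1)] nonneg[OF j(1)] P j(2)
      unfolding P_def Let_def reals clears by (auto simp: sel)
  qed
  then have P: "P Js (fst (exec cut_program s0))"
    and cost: "snd (exec cut_program s0) \<le> (\<Sum>j\<leftarrow>Js. 27 * length (Is j))"
    unfolding l by auto
  show "reals (fst (exec cut_program s0)) ''const'' [] = (\<Sum>j\<in>{1..n}. cut_const m d p yt j)"
    "reals (fst (exec cut_program s0)) ''coef'' [i] = (\<Sum>j\<in>{1..n}. cut_coef m d p yt sel j i)"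
    using P Js(2) by (simp_all add: P_def)
  have "(\<Sum>j\<leftarrow>Js. 27 * length (Is j)) = (\<Sum>j\<in>{1..n}. 27 * length (Is j))"
    using Js by (simp add: sum_list_distinct_conv_sum_set)
  also have "\<dots> = 27 * (\<Sum>j\<in>{1..n}. card (cover m p j))"
    unfolding sum_distrib_left
    using Is by (intro sum.cong) (auto simp flip: distinct_card)
  finally show "run_time cut_program s0 \<le> 27 * (\<Sum>j\<in>{1..n}. card (cover m p j))"
    using cost by (simp add: run_time_def)
qed

lemma cut_program_computes_cut:
  assumes inst: "covering_instance m n d p" and yt: "yt \<in> unit_box m"
    and Js: "distinct Js" "set Js = {1..n}"
    and Is: "\<forall>j\<in>{1..n}. distinct (Is j) \<and> set (Is j) = cover m p j"
  shows "run_time cut_program (input_state d p yt Js Is tie)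
      \<le> 27 * (\<Sum>j\<in>{1..n}. card (cover m p j))"
    and "\<exists>sel. (\<forall>j\<in>JQ m n p yt. is_minimizer m p yt j (sel j)) \<and>
      (\<forall>j\<in>JQ m n p yt. is_minimizer m p yt j (tie j) \<longrightarrow> sel j = tie j) \<and>
      (\<forall>y. output_lhs m cut_program (input_state d p yt Js Is tie) y =
           cut_lhs m n d p yt sel y)"
proof -
  have nonneg: "0 \<le> (1 - p i j) * yt i" if "j \<in> {1..n}" "i \<in> cover m p j" for i j
    using that yt by (auto simp: cover_def unit_box_def)
  define sel where "sel = (\<lambda>j. selected (\<lambda>i. (1 - p i j) * yt i) (Is j) (tie j))"
  note correct = cut_program_correct[OF nonneg Js Is[rule_format] sel_def]
  show "run_time cut_program (input_state d p yt Js Is tie)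
      \<le> 27 * (\<Sum>j\<in>{1..n}. card (cover m p j))"
    by (rule correct(3))
  have minimizer: "is_minimizer m p yt j (sel j)"
    and tie: "is_minimizer m p yt j (tie j) \<longrightarrow> sel j = tie j"
    and cover: "sel j \<in> cover m p j"
    if "j \<in> JQ m n p yt" for j
  proof -
    from that have j: "j \<in> {1..n}" and lt: "Q m p yt j < N m p yt j"
      by (auto simp: JQ_def)
    then have set: "set (Is j) = cover m p j"
      using Is by blast
    have "cover m p j \<noteq> {}"
      using lt by (auto simp: Q_def N_def)
    then have ne: "Is j \<noteq> []"
      using set by auto
    let ?w = "\<lambda>i. (1 - p i j) * yt i"
    have pos: "0 \<le> ?w i" if "i \<in> set (Is j)" for i
      using that nonneg[OF j] set by blast
    note props = selected_properties[of "Is j" ?w "tie j", OF ne pos, simplified set]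
    show cover: "sel j \<in> cover m p j"
      using props(1) unfolding sel_def by simp
    show "is_minimizer m p yt j (sel j)"
      unfolding is_minimizer_iff[OF cover] using props(2) unfolding sel_def by simp
    show "is_minimizer m p yt j (tie j) \<longrightarrow> sel j = tie j"
    proof
      assume min: "is_minimizer m p yt j (tie j)"
      then have "tie j \<in> cover m p j"
        by (simp add: is_minimizer_def is_arg_min_def)
      with min show "sel j = tie j"
        using props(3) unfolding sel_def by (simp add: is_minimizer_iff)
    qed
  qed
  moreover have "output_lhs m cut_program (input_state d p yt Js Is tie) y =
      cut_lhs m n d p yt sel y" for y
  proof -
    let ?t = "fst (exec cut_program (input_state d p yt Js Is tie))"
    have const: "reals ?t ''const'' [] = (\<Sum>j\<in>{1..n}. cut_const m d p yt j)"
      by (rule correct(1))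
    have coef: "reals ?t ''coef'' [i] = (\<Sum>j\<in>{1..n}. cut_coef m d p yt sel j i)" for i
      by (rule correct(2))
    have "\<forall>j\<in>JQ m n p yt. sel j \<in> cover m p j"
      using cover by blast
    then show ?thesis
      unfolding output_lhs_def const coef by (rule cut_lhs_eq_coefs[symmetric])
  qed
  ultimately show "\<exists>sel. (\<forall>j\<in>JQ m n p yt. is_minimizer m p yt j (sel j)) \<and>
      (\<forall>j\<in>JQ m n p yt. is_minimizer m p yt j (tie j) \<longrightarrow> sel j = tie j) \<and>
      (\<forall>y. output_lhs m cut_program (input_state d p yt Js Is tie) y =
           cut_lhs m n d p yt sel y)"
    by blast
qed

theorem mainTheorem4:
  shows
  "(\<forall>m n (d :: nat \<Rightarrow> real) (p :: nat \<Rightarrow> nat \<Rightarrow> real) (yt :: nat \<Rightarrow> real) (sel :: nat \<Rightarrow> nat).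
      covering_instance m n d p \<and> yt \<in> unit_box m \<and>
      (\<forall>j\<in>JQ m n p yt. is_minimizer m p yt j (sel j)) \<longrightarrow>
        (\<forall>y\<in>unit_box m. \<forall>\<theta>::real. \<theta> \<le> V m n d p y \<longrightarrow> cut_lhs m n d p yt sel y \<ge> \<theta>) \<and>
        cut_lhs m n d p yt sel yt = (\<Sum>j\<in>{1..n}. d j * min (Q m p yt j) (N m p yt j)) \<and>
        (\<Sum>j\<in>{1..n}. d j * min (Q m p yt j) (N m p yt j)) = V m n d p yt)
   \<and>
   (\<exists>(c :: com) (C :: nat).
      \<forall>m n (d :: nat \<Rightarrow> real) (p :: nat \<Rightarrow> nat \<Rightarrow> real) (yt :: nat \<Rightarrow> real)
       (Js :: nat list) (Is :: nat \<Rightarrow> nat list) (tie :: nat \<Rightarrow> nat).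
        covering_instance m n d p \<and> yt \<in> unit_box m \<and>
        distinct Js \<and> set Js = {1..n} \<and>
        (\<forall>j\<in>{1..n}. distinct (Is j) \<and> set (Is j) = cover m p j) \<longrightarrow>
          run_time c (input_state d p yt Js Is tie) \<le> C * (\<Sum>j\<in>{1..n}. card (cover m p j)) \<and>
          (\<exists>sel. (\<forall>j\<in>JQ m n p yt. is_minimizer m p yt j (sel j)) \<and>
                 (\<forall>j\<in>JQ m n p yt. is_minimizer m p yt j (tie j) \<longrightarrow> sel j = tie j) \<and>
                 (\<forall>y. output_lhs m c (input_state d p yt Js Is tie) y =
                      cut_lhs m n d p yt sel y)))"
proof (rule conjI; (rule exI[of _ cut_program], rule exI[of _ 27])?;
    intro conjI allI impI ballI; elim conjE)
  fix m n d p yt sel y and \<theta> :: real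
  assume "covering_instance m n d p" "y \<in> unit_box m"
    "\<forall>j\<in>JQ m n p yt. is_minimizer m p yt j (sel j)" "\<theta> \<le> V m n d p y"
  then show "\<theta> \<le> cut_lhs m n d p yt sel y"
    using cut_valid by (meson order_trans)
next
  fix m n d p yt sel
  assume "\<forall>j\<in>JQ m n p yt. is_minimizer m p yt j (sel j)"
  then show "cut_lhs m n d p yt sel yt = (\<Sum>j\<in>{1..n}. d j * min (Q m p yt j) (N m p yt j))"
    by (rule cut_tight)
next
  fix m n d p yt
  assume "covering_instance m n d p" "yt \<in> unit_box m"
  then show "(\<Sum>j\<in>{1..n}. d j * min (Q m p yt j) (N m p yt j)) = V m n d p yt"
    by (rule V_eq[symmetric])
next
  fix m n d p yt Js Is tie
  assume "covering_instance m n d p" "yt \<in> unit_box m" "distinct Js" "set Js = {1..n}"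
    "\<forall>j\<in>{1..n}. distinct (Is j) \<and> set (Is j) = cover m p j"
  note computes = cut_program_computes_cut[OF this]
  show "run_time cut_program (input_state d p yt Js Is tie)
      \<le> 27 * (\<Sum>j\<in>{1..n}. card (cover m p j))"
    by (rule computes(1))
  show "\<exists>sel. (\<forall>j\<in>JQ m n p yt. is_minimizer m p yt j (sel j)) \<and>
      (\<forall>j\<in>JQ m n p yt. is_minimizer m p yt j (tie j) \<longrightarrow> sel j = tie j) \<and>
      (\<forall>y. output_lhs m cut_program (input_state d p yt Js Is tie) y =
           cut_lhs m n d p yt sel y)"
    by (rule computes(2))
qed

end
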